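(* If $\Lambda\subseteq\mathbb{Z}^n$ is an integer lattice (a lattice of rank $n$ with a generator matrix having integer entries) which is a tiling with $\Upsilon_n$, then either $n=2^t-1$ or $n=3^t-1$ for some $t>0$.
   Context: $\Upsilon_n=\{U\in\mathbb{Z}^n:\sum_i|x_i-u_i|\le1\text{ for some }X\in\{-1,0\}^n\}$. A set $T\subseteq\mathbb{Z}^n$ is a tiling with $\Upsilon_n$ if the translates $X+\Upsilon_n$, $X\in T$, partition $\mathbb{Z}^n$. *)

theory Defs
  imports "HOL-Analysis.Analysis"
begin

definition Upsilon :: "(int ^ 'n) set" where
  "Upsilon = {U. \<exists>X. (\<forall>i. X $ i \<in> {-1, 0}) \<and> (\<Sum>i\<in>UNIV. \<bar>X $ i - U $ i\<bar>) \<le> 1}"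

text \<open>
  The partition is indexed by \<^term>\<open>T\<close>: translates by distinct elements must be disjoint,
  so no translate may be used twice.
\<close>

definition is_tiling :: "(int ^ 'n) set \<Rightarrow> (int ^ 'n) set \<Rightarrow> bool" where
  "is_tiling S T \<longleftrightarrow>
     (\<Union>X\<in>T. (+) X ` S) = UNIV \<and> disjoint_family_on (\<lambda>X. (+) X ` S) T"

text \<open>
  The rows of the generator matrix \<^term>\<open>G\<close> are the basis vectors. The rank is taken over the
  reals, so the second conjunct says that these \<open>CARD('n)\<close> vectors are linearly independent
  in real \<open>n\<close>-space.
\<close>

definition is_generator_matrix :: "int ^ 'n ^ 'n \<Rightarrow> (int ^ 'n) set \<Rightarrow> bool" where
  "is_generator_matrix G \<Lambda> \<longleftrightarrow>
     \<Lambda> = range (\<lambda>u. u v* G) \<and> rank (\<chi> i j. real_of_int (G $ i $ j)) = CARD('n)"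

definition is_integer_lattice :: "(int ^ 'n) set \<Rightarrow> bool" where
  "is_integer_lattice \<Lambda> \<longleftrightarrow> (\<exists>G. is_generator_matrix G \<Lambda>)"

end

theory Submission
  imports Defs
begin

text \<open>
  Write \<open>e\<^sub>i\<close> for the unit vectors and \<open>S\<^sub>i\<close> for the translation by \<open>e\<^sub>i\<close>. Summation over \<open>\<Upsilon>\<^sub>n\<close> factors as
  \<open>\<Prod>\<^sub>i (1 + S\<^sub>i\<^sup>-\<^sup>1)\<close> times \<open>M = \<Sum>\<^sub>i (S\<^sub>i + S\<^sub>i\<^sup>-\<^sup>1) - (n - 1)\<close>. Let \<open>p\<close> be an odd prime with
  \<open>n + 1 = p\<^sup>a m\<close>, \<open>p\<close> not dividing \<open>m\<close>, put \<open>q = 2\<^sup>n m\<close>, let \<open>W \<supseteq> \<Lambda>\<close> have index \<open>p\<close>, and let \<open>L \<supseteq> \<Lambda>\<close> be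
  a subgroup containing all \<open>q x\<close>. The function \<open>f = (p 1\<^sub>W - 1) 1\<^sub>L\<close> is periodic with respect to \<open>\<Lambda>\<close>
  and has mean zero, so the tiling gives \<open>\<Prod>\<^sub>i (1 + S\<^sub>i\<^sup>-\<^sup>1) M f = 0\<close>. Because \<open>q\<close> is even, the
  factors with \<open>e\<^sub>i \<notin> W\<close> act injectively on the translates of \<open>f\<close> and can be removed.

  For \<open>L\<close> the whole group, the remaining equation says that the number \<open>e\<close> of indices with
  \<open>e\<^sub>i \<notin> W\<close> satisfies \<open>2 e p = (p - 1) (n + 1)\<close>. For \<open>L/\<Lambda>\<close> the \<open>p\<close>-part of the quotient, its
  value at the origin forces at least \<open>e\<close> points of \<open>\<Upsilon>\<^sub>n\<close> into \<open>L \<inter> W\<close>; these are distinct modulo \<open>\<Lambda>\<close>,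
  so \<open>e \<le> p\<^sup>a\<^sup>-\<^sup>1\<close>. Hence \<open>(p - 1) m \<le> 2\<close>, that is \<open>p = 3\<close> and \<open>n + 1 = 3\<^sup>a\<close>.
\<close>

section \<open>Subgroups of the integer lattice\<close>

definition add_subgroup :: "(int ^ 'n) set \<Rightarrow> bool" where
  "add_subgroup A \<longleftrightarrow> 0 \<in> A \<and> (\<forall>x\<in>A. \<forall>y\<in>A. x - y \<in> A)"

lemma add_subgroup_zero: "add_subgroup A \<Longrightarrow> 0 \<in> A"
  by (simp add: add_subgroup_def)

lemma add_subgroup_diff: "add_subgroup A \<Longrightarrow> x \<in> A \<Longrightarrow> y \<in> A \<Longrightarrow> x - y \<in> A"
  by (simp add: add_subgroup_def)

lemma add_subgroup_uminus: "add_subgroup A \<Longrightarrow> x \<in> A \<Longrightarrow> - x \<in> A"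
  using add_subgroup_diff[of A 0 x] by (simp add: add_subgroup_zero)

lemma add_subgroup_add: "add_subgroup A \<Longrightarrow> x \<in> A \<Longrightarrow> y \<in> A \<Longrightarrow> x + y \<in> A"
  using add_subgroup_diff[of A x "- y"] by (simp add: add_subgroup_uminus)

lemma add_subgroup_scale:
  assumes "add_subgroup A" and "x \<in> A"
  shows "k *s x \<in> A"
proof -
  have nat: "int m *s x \<in> A" for m
  proof (induction m)
    case 0
    then show ?case using assms(1) by (simp add: add_subgroup_zero)
  next
    case (Suc m)
    then show ?case using add_subgroup_add[OF assms(1) Suc assms(2)]
      by (simp add: vector_sadd_rdistrib add.commute)
  qed
  show ?thesis
  proof (cases "k \<ge> 0")
    case True
    then show ?thesis using nat[of "nat k"] by simp
  next
    case False
    moreover have "k *s x = - ((- k) *s x)" by (simp add: vec_eq_iff)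
    ultimately show ?thesis using add_subgroup_uminus[OF assms(1) nat[of "nat (- k)"]] by simp
  qed
qed

lemma add_subgroup_cancel:
  assumes "add_subgroup A" and "y \<in> A"
  shows "x + y \<in> A \<longleftrightarrow> x \<in> A" and "y + x \<in> A \<longleftrightarrow> x \<in> A" and "x - y \<in> A \<longleftrightarrow> x \<in> A"
proof -
  show *: "x + y \<in> A \<longleftrightarrow> x \<in> A" for x
    using add_subgroup_add[OF assms(1) _ assms(2), of x]
      add_subgroup_diff[OF assms(1) _ assms(2), of "x + y"] by auto
  show "y + x \<in> A \<longleftrightarrow> x \<in> A" using *[of x] by (simp only: add.commute)
  show "x - y \<in> A \<longleftrightarrow> x \<in> A" using *[of "x - y"] by simp
qed

lemma add_subgroup_Int: "add_subgroup A \<Longrightarrow> add_subgroup B \<Longrightarrow> add_subgroup (A \<inter> B)"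
  by (auto simp: add_subgroup_def)

lemma add_subgroup_UNIV: "add_subgroup UNIV"
  by (simp add: add_subgroup_def)

lemma add_subgroup_torsion:
  assumes "add_subgroup A"
  shows "add_subgroup {x. k *s x \<in> A}"
  using assms by (auto simp: add_subgroup_def vector_ssub_ldistrib)

lemma add_subgroup_sum:
  assumes "add_subgroup A" "\<And>i. i \<in> S \<Longrightarrow> g i \<in> A"
  shows "sum g S \<in> A"
  using assms(2)
  by (induction S rule: infinite_finite_induct)
    (simp_all add: add_subgroup_zero[OF assms(1)] add_subgroup_add[OF assms(1)])

text \<open>Bezout: \<open>x\<close> is an integer combination of \<open>k *s x\<close> and
  \<open>m *s x\<close>. The main use is that a multiple by a number prime to \<open>p\<close> stays
  outside a subgroup \<open>W\<close> containing all \<open>int p *s x\<close>.\<close>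

lemma add_subgroup_coprime_scale:
  assumes W: "add_subgroup W" and "k *s x \<in> W" "m *s x \<in> W" "coprime k m"
  shows "x \<in> W"
proof -
  obtain a b where ab: "a * k + b * m = 1"
    using assms(4) by (metis bezout_int coprime_imp_gcd_eq_1)
  have "a *s (k *s x) + b *s (m *s x) \<in> W"
    by (intro add_subgroup_add[OF W] add_subgroup_scale[OF W] assms(2,3))
  also have "a *s (k *s x) + b *s (m *s x) = x"
    unfolding vector_smult_assoc vector_sadd_rdistrib[symmetric] ab by simp
  finally show ?thesis .
qed

text \<open>For a subgroup \<open>B\<close> this is the subgroup generated by \<open>B\<close> and
  \<open>v\<close>. Larger subgroups are reached by adjoining one generator at a time, so that every
  step has a cyclic quotient.\<close>

definition adjoin :: "(int ^ 'n) set \<Rightarrow> int ^ 'n \<Rightarrow> (int ^ 'n) set" where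
  "adjoin B v = {b + k *s v | b k. b \<in> B}"

lemma add_subgroup_adjoin:
  assumes "add_subgroup B"
  shows "add_subgroup (adjoin B v)"
  unfolding add_subgroup_def
proof (intro conjI ballI)
  have "0 = 0 + 0 *s v" by simp
  then show "0 \<in> adjoin B v"
    using add_subgroup_zero[OF assms] unfolding adjoin_def by blast
  fix x y assume "x \<in> adjoin B v" "y \<in> adjoin B v"
  then obtain b k c l where xy: "b \<in> B" "c \<in> B" "x = b + k *s v" "y = c + l *s v"
    unfolding adjoin_def by blast
  have "x - y = (b - c) + (k - l) *s v"
    unfolding xy by (simp add: vec_eq_iff algebra_simps)
  then show "x - y \<in> adjoin B v"
    using add_subgroup_diff[OF assms xy(1,2)] unfolding adjoin_def by blast
qed

lemma adjoin_superset: "B \<subseteq> adjoin B v"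
proof
  fix b assume "b \<in> B"
  moreover have "b = b + 0 *s v" by simp
  ultimately show "b \<in> adjoin B v" unfolding adjoin_def by blast
qed

lemma adjoin_generator:
  assumes "add_subgroup B"
  shows "v \<in> adjoin B v"
proof -
  have "v = 0 + 1 *s v" by simp
  then show ?thesis using add_subgroup_zero[OF assms] unfolding adjoin_def by blast
qed

lemma adjoin_least: "add_subgroup A \<Longrightarrow> B \<subseteq> A \<Longrightarrow> v \<in> A \<Longrightarrow> adjoin B v \<subseteq> A"
  unfolding adjoin_def by (auto intro!: add_subgroup_add add_subgroup_scale)

section \<open>Index computations with a transversal\<close>

text \<open>\<open>U\<close> represents each coset of \<Lambda> exactly once. For a subgroup
  \<open>A\<close> above \<Lambda> the number \<open>card (U \<inter> A)\<close> is therefore the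
  index of \<Lambda> in \<open>A\<close>, so orders in the quotient are computed without
  constructing the quotient.\<close>

locale lattice_transversal =
  fixes \<Lambda> U :: "(int ^ 'n) set"
  assumes subgroup: "add_subgroup \<Lambda>"
    and finite_U: "finite U"
    and covers: "\<And>x. \<exists>u\<in>U. x - u \<in> \<Lambda>"
    and distinct: "\<And>u v. u \<in> U \<Longrightarrow> v \<in> U \<Longrightarrow> u - v \<in> \<Lambda> \<Longrightarrow> u = v"
begin

definition rep :: "int ^ 'n \<Rightarrow> int ^ 'n" where
  "rep x = (SOME u. u \<in> U \<and> x - u \<in> \<Lambda>)"

lemma rep: "rep x \<in> U" "x - rep x \<in> \<Lambda>"
  using someI_ex[of "\<lambda>u. u \<in> U \<and> x - u \<in> \<Lambda>"] covers[of x] unfolding rep_def by blast+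

lemma rep_unique:
  assumes "u \<in> U" "x - u \<in> \<Lambda>"
  shows "rep x = u"
proof -
  have "u - rep x = (x - rep x) - (x - u)" by simp
  also have "\<dots> \<in> \<Lambda>" by (rule add_subgroup_diff[OF subgroup rep(2) assms(2)])
  finally show ?thesis using distinct[OF assms(1) rep(1)] by metis
qed

lemma rep_eq_iff: "rep x = rep y \<longleftrightarrow> x - y \<in> \<Lambda>"
proof
  assume "rep x = rep y"
  then show "x - y \<in> \<Lambda>"
    using add_subgroup_diff[OF subgroup rep(2)[of x] rep(2)[of y]] by simp
next
  assume "x - y \<in> \<Lambda>"
  then have "x - rep y \<in> \<Lambda>"
    using add_subgroup_add[OF subgroup _ rep(2)[of y], of "x - y"] by simp
  then show "rep x = rep y"
    using rep_unique rep(1) by blast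
qed

lemma rep_mem_iff:
  assumes "add_subgroup A" "\<Lambda> \<subseteq> A"
  shows "rep x \<in> A \<longleftrightarrow> x \<in> A"
proof -
  have "x - rep x \<in> A" using rep(2) assms(2) by blast
  from add_subgroup_cancel(2)[OF assms(1) this, of "rep x"] show ?thesis by simp
qed

lemma inj_on_rep_translate: "inj_on (\<lambda>u. rep (x + u)) U"
proof (rule inj_onI)
  fix u v assume *: "u \<in> U" "v \<in> U" "rep (x + u) = rep (x + v)"
  then have "u - v \<in> \<Lambda>" using rep_eq_iff[of "x + u" "x + v"] by simp
  then show "u = v" using distinct * by blast
qed

text \<open>Translation by \<open>x\<close> permutes the cosets of \<Lambda>, hence their
  representatives.\<close>

lemma sum_translate:
  fixes f :: "int ^ 'n \<Rightarrow> int"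
  assumes "\<And>x l. l \<in> \<Lambda> \<Longrightarrow> f (x + l) = f x"
  shows "(\<Sum>u\<in>U. f (x + u)) = (\<Sum>u\<in>U. f u)"
proof -
  have f_rep: "f (rep y) = f y" for y
    using assms[OF rep(2)[of y], of "rep y"] by simp
  have "(\<lambda>u. rep (x + u)) ` U = U"
    by (intro endo_inj_surj finite_U inj_on_rep_translate image_subsetI rep(1))
  then have "(\<Sum>u\<in>U. f u) = (\<Sum>u\<in>U. f (rep (x + u)))"
    using sum.reindex[OF inj_on_rep_translate, of f x] by (simp only: o_def)
  then show ?thesis by (simp only: f_rep)
qed

lemma card_less:
  assumes "add_subgroup A" "\<Lambda> \<subseteq> B" "B \<subset> A" "add_subgroup B"
  shows "card (U \<inter> B) < card (U \<inter> A)"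
proof (rule psubset_card_mono)
  show "finite (U \<inter> A)" using finite_U by simp
  obtain x where "x \<in> A" "x \<notin> B" using assms by blast
  then have "rep x \<in> A" "rep x \<notin> B" using rep_mem_iff assms by blast+
  then show "U \<inter> B \<subset> U \<inter> A" using rep(1)[of x] assms by blast
qed

lemma card_U_lattice: "card (U \<inter> \<Lambda>) = 1"
proof -
  have "rep 0 \<in> U \<inter> \<Lambda>"
    using rep(1) rep_mem_iff[OF subgroup order_refl] add_subgroup_zero[OF subgroup] by blast
  then have "U \<inter> \<Lambda> = {rep 0}"
    using distinct add_subgroup_diff[OF subgroup] by blast
  then show ?thesis by simp
qed

text \<open>Pigeonhole: among the \<open>card U + 1\<close> multiples \<open>int j *s v\<close> with
  \<open>j \<le> card U\<close>, two lie in the same coset.\<close>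

lemma scale_mem_lattice: "\<exists>k>0. int k *s v \<in> \<Lambda>"
proof -
  have "card ((\<lambda>j. rep (int j *s v)) ` {0..card U}) \<le> card U"
    by (intro card_mono finite_U) (auto simp: rep)
  then have "\<not> inj_on (\<lambda>j. rep (int j *s v)) {0..card U}"
    by (auto dest!: card_image)
  then obtain i j where "i < j" "rep (int i *s v) = rep (int j *s v)"
    unfolding inj_on_def by (metis linorder_neqE_nat)
  then have "int (j - i) *s v \<in> \<Lambda>" "j - i > 0"
    using rep_eq_iff[of "int j *s v" "int i *s v"] by (simp_all add: vector_sub_rdistrib of_nat_diff)
  then show ?thesis by blast
qed

text \<open>The factor \<open>r\<close> is the order of \<open>v\<close> modulo \<open>B\<close>:
  representatives of \<open>adjoin B v\<close> correspond to pairs of a representative of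
  \<open>B\<close> and an exponent below \<open>r\<close>.\<close>

lemma card_adjoin:
  assumes B: "add_subgroup B" "\<Lambda> \<subseteq> B"
  obtains r where "r > 0" "card (U \<inter> adjoin B v) = r * card (U \<inter> B)"
    "\<And>k. k *s v \<in> B \<longleftrightarrow> int r dvd k"
proof -
  define r where "r = (LEAST k. k > 0 \<and> int k *s v \<in> B)"
  have ex: "\<exists>k. k > 0 \<and> int k *s v \<in> B"
    using scale_mem_lattice[of v] B by blast
  have r: "r > 0" "int r *s v \<in> B"
    using LeastI_ex[OF ex] unfolding r_def by auto
  have least: "k \<ge> r" if "k > 0" "int k *s v \<in> B" for k
    using Least_le[of "\<lambda>k. k > 0 \<and> int k *s v \<in> B"] that unfolding r_def by blast
  have dvd: "k *s v \<in> B \<longleftrightarrow> int r dvd k" for k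
  proof
    assume "int r dvd k"
    then obtain m where "k = m * int r" by (metis dvdE mult.commute)
    then show "k *s v \<in> B" using add_subgroup_scale[OF B(1) r(2), of m] by (simp add: vector_smult_assoc)
  next
    assume k: "k *s v \<in> B"
    \<comment> \<open>Division with remainder: the remainder also carries \<open>v\<close> into
      \<open>B\<close>, so minimality of \<open>r\<close> makes it zero.\<close>
    have "(k mod int r) *s v = k *s v - (k div int r) *s (int r *s v)"
      by (simp add: vector_smult_assoc minus_div_mult_eq_mod[symmetric] vector_sub_rdistrib)
    then have "int (nat (k mod int r)) *s v \<in> B"
      using add_subgroup_diff[OF B(1) k add_subgroup_scale[OF B(1) r(2)]] r(1) by simp
    moreover have "nat (k mod int r) < r" using r(1) by (simp add: nat_less_iff)
    ultimately have "\<not> nat (k mod int r) > 0" using least[of "nat (k mod int r)"] by linarith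
    moreover have "k mod int r \<ge> 0" using r(1) by simp
    ultimately have "k mod int r = 0" by linarith
    then show "int r dvd k" by presburger
  qed
  let ?g = "\<lambda>(u, j). rep (u + int j *s v)"
  have "bij_betw ?g ((U \<inter> B) \<times> {..<r}) (U \<inter> adjoin B v)"
  proof (rule bij_betw_imageI)
    show "inj_on ?g ((U \<inter> B) \<times> {..<r})"
    proof (intro inj_onI, clarsimp)
      fix u i w j assume *: "u \<in> U" "u \<in> B" "i < r" "w \<in> U" "w \<in> B" "j < r"
        "rep (u + int i *s v) = rep (w + int j *s v)"
      then have **: "u + int i *s v - (w + int j *s v) \<in> \<Lambda>" by (simp add: rep_eq_iff)
      have "u + int i *s v - (w + int j *s v) = (int i - int j) *s v + (u - w)"
        by (simp add: vector_sub_rdistrib)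
      with ** B(2) have "(int i - int j) *s v + (u - w) \<in> B" by auto
      then have "(int i - int j) *s v \<in> B"
        using add_subgroup_cancel(1)[OF B(1) add_subgroup_diff[OF B(1)]] * by blast
      then have "int r dvd int i - int j" by (simp only: dvd)
      then have "i = j" using * dvd_imp_le_int[of "int i - int j" "int r"] by linarith
      then show "u = w \<and> i = j" using ** * distinct by auto
    qed
    show "?g ` ((U \<inter> B) \<times> {..<r}) = U \<inter> adjoin B v"
    proof safe
      fix u j assume "u \<in> U" "u \<in> B" "j < r"
      then show "rep (u + int j *s v) \<in> U" "rep (u + int j *s v) \<in> adjoin B v"
        using adjoin_superset[of B v] B
        by (auto simp: rep rep_mem_iff add_subgroup_adjoin) (auto simp: adjoin_def)
    next
      fix w assume w: "w \<in> U" "w \<in> adjoin B v"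
      then obtain b k where bk: "b \<in> B" "w = b + k *s v" unfolding adjoin_def by blast
      define j where "j = nat (k mod int r)"
      have j: "j < r" "int j = k mod int r" using r(1) by (auto simp: j_def nat_less_iff)
      \<comment> \<open>Surjectivity: subtracting \<open>j\<close> copies of \<open>v\<close> brings
        \<open>w\<close> into \<open>B\<close>; the representative of the result, paired with
        \<open>j\<close>, is a preimage of \<open>w\<close>.\<close>
      have "w - int j *s v = b + (k - int j) *s v" 
        by (simp add: bk vector_sub_rdistrib)
      moreover have "(k - int j) *s v \<in> B" by (simp only: dvd j dvd_minus_mod)
      ultimately have "w - int j *s v \<in> B" using add_subgroup_add[OF B(1) bk(1)] by (simp only:)
      then have "rep (w - int j *s v) \<in> B" using rep_mem_iff B by blast
      moreover have "rep (rep (w - int j *s v) + int j *s v) = w"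
        using rep(2)[of "w - int j *s v"] add_subgroup_uminus[OF subgroup, of "w - int j *s v - rep (w - int j *s v)"]
        by (intro rep_unique w) (simp add: algebra_simps)
      ultimately show "w \<in> ?g ` ((U \<inter> B) \<times> {..<r})"
        using j(1) rep(1) by (intro image_eqI[of _ _ "(rep (w - int j *s v), j)"]) auto
    qed
  qed
  then have "card (U \<inter> adjoin B v) = r * card (U \<inter> B)"
    by (auto dest!: bij_betw_same_card simp: card_cartesian_product mult.commute)
  then show thesis using that r(1) dvd by blast
qed

text \<open>The witness \<open>r\<close> is the index of \<open>B\<close> in \<open>A\<close>, and
  the second clause is Cauchy's theorem for \<open>A/B\<close>: a prime divisor of the order divides
  every exponent. Adjoining one generator at a time multiplies the index by the order of that
  generator, and this order divides every exponent.\<close>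

lemma index_exists:
  assumes B: "add_subgroup B" "\<Lambda> \<subseteq> B" and A: "add_subgroup A" "B \<subseteq> A"
  shows "\<exists>r. card (U \<inter> A) = r * card (U \<inter> B) \<and>
    (\<forall>k s. (\<forall>x\<in>A. int k *s x \<in> B) \<longrightarrow> prime s \<longrightarrow> s dvd r \<longrightarrow> s dvd k)"
  using B A(2)
proof (induction "card (U \<inter> A) - card (U \<inter> B)" arbitrary: B rule: less_induct)
  case less
  show ?case
  proof (cases "B = A")
    case True
    then show ?thesis by (intro exI[of _ 1]) auto
  next
    case False
    then obtain v where v: "v \<in> A" "v \<notin> B" using less.prems by blast
    let ?B = "adjoin B v"
    obtain r where "r > 0" and r: "card (U \<inter> ?B) = r * card (U \<inter> B)"
      "\<And>k. k *s v \<in> B \<longleftrightarrow> int r dvd k"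
      using card_adjoin[OF less.prems(1,2), where v = v] by blast
    have sub: "add_subgroup ?B" "\<Lambda> \<subseteq> ?B" "?B \<subseteq> A" "B \<subseteq> ?B" "v \<in> ?B"
      using less.prems add_subgroup_adjoin adjoin_superset adjoin_least[OF A(1)] v(1)
        adjoin_generator by blast+
    have "card (U \<inter> B) < card (U \<inter> ?B)" "card (U \<inter> ?B) \<le> card (U \<inter> A)"
      using sub less.prems v by (auto intro!: card_less card_mono simp: finite_U)
    then have "card (U \<inter> A) - card (U \<inter> ?B) < card (U \<inter> A) - card (U \<inter> B)" by simp
    from less.hyps[OF this sub(1-3)] obtain m where m: "card (U \<inter> A) = m * card (U \<inter> ?B)"
      "\<And>k s. (\<forall>x\<in>A. int k *s x \<in> ?B) \<Longrightarrow> prime s \<Longrightarrow> s dvd m \<Longrightarrow> s dvd k" by blast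
    have "s dvd k" if "\<forall>x\<in>A. int k *s x \<in> B" "prime s" "s dvd m * r" for k s
    proof -
      have "r dvd k" using that(1) v(1) r(2)[of "int k"] by simp
      moreover have "s dvd m \<or> s dvd r" using that(2,3) by (simp add: prime_dvd_mult_iff)
      moreover have "s dvd m \<Longrightarrow> s dvd k" using m(2) that(1,2) sub(4) by blast
      ultimately show ?thesis by (meson dvd_trans)
    qed
    then show ?thesis using m(1) r(1) by (intro exI[of _ "m * r"]) auto
  qed
qed

text \<open>Lagrange: the order of \<open>x\<close> modulo \<Lambda> is the index of \<Lambda> in
  \<open>adjoin \<Lambda> x\<close>, which divides \<open>card U\<close>.\<close>

lemma card_scale_mem_lattice: "int (card U) *s x \<in> \<Lambda>"
proof -
  obtain r where "r > 0" and r: "card (U \<inter> adjoin \<Lambda> x) = r * card (U \<inter> \<Lambda>)"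
    "\<And>k. k *s x \<in> \<Lambda> \<longleftrightarrow> int r dvd k"
    using card_adjoin[OF subgroup order_refl, where v = x] by blast
  obtain m where "card (U \<inter> UNIV) = m * card (U \<inter> adjoin \<Lambda> x)"
    using index_exists[OF add_subgroup_adjoin[OF subgroup] adjoin_superset add_subgroup_UNIV] by blast
  then have "card U = m * r" using r(1) card_U_lattice by simp
  then show ?thesis by (simp add: r(2))
qed

text \<open>The torsion part has exponent \<open>p ^ a\<close>, so by Cauchy its order has no prime
  factor other than \<open>p\<close> and is coprime to \<open>q\<close>; by Lagrange the order
  divides \<open>p ^ a * q\<close>.\<close>

lemma card_torsion_dvd:
  assumes "prime p" "card U = p ^ a * q" "\<not> p dvd q"
  shows "card (U \<inter> {x. int (p ^ a) *s x \<in> \<Lambda>}) dvd p ^ a"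
proof -
  let ?L = "{x. int (p ^ a) *s x \<in> \<Lambda>}"
  have L: "add_subgroup ?L" "\<Lambda> \<subseteq> ?L"
    using add_subgroup_torsion[OF subgroup] add_subgroup_scale[OF subgroup] by auto
  obtain r where r: "card (U \<inter> ?L) = r" and
    s: "\<And>k s. (\<forall>x\<in>?L. int k *s x \<in> \<Lambda>) \<Longrightarrow> prime s \<Longrightarrow> s dvd r \<Longrightarrow> s dvd k"
    using index_exists[OF subgroup order_refl L] card_U_lattice by auto
  obtain m where "card U = m * r"
    using index_exists[OF L add_subgroup_UNIV] r by auto
  then have "r dvd p ^ a * q" using assms(2) by simp
  moreover have "coprime r q"
  proof (rule ccontr)
    assume "\<not> coprime r q"
    then have "gcd r q \<noteq> 1" by (simp add: coprime_iff_gcd_eq_1)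
    then obtain t where t: "prime t" "t dvd r" "t dvd q"
      using prime_factor_nat[of "gcd r q"] by auto
    then have "t dvd p ^ a" using s[of "p ^ a" t] by auto
    then have "t = p" using assms(1) t(1) prime_dvd_power primes_dvd_imp_eq by blast
    then show False using t(3) assms(3) by simp
  qed
  ultimately show ?thesis using r by (simp add: coprime_dvd_mult_left_iff)
qed

text \<open>This supplies the subgroup of index \<open>p\<close>: maximality makes the quotient
  simple, and it is killed by \<open>p\<close>. The starting point is the subgroup \<open>W0\<close>
  generated by \<Lambda> and all multiples of \<open>p\<close>; the work lies in showing it
  proper.\<close>

lemma maximal_subgroup_exists:
  assumes p: "prime p" "p dvd card U"
  obtains W where "add_subgroup W" "\<Lambda> \<subseteq> W" "\<And>x. int p *s x \<in> W" "W \<noteq> UNIV"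
    "\<And>B. add_subgroup B \<Longrightarrow> W \<subset> B \<Longrightarrow> B = UNIV"
proof -
  let ?P = "\<lambda>W. add_subgroup W \<and> \<Lambda> \<subseteq> W \<and> (\<forall>x. int p *s x \<in> W) \<and> W \<noteq> UNIV"
  define W0 where "W0 = {int p *s y + l | y l. l \<in> \<Lambda>}"
  have "add_subgroup W0"
    unfolding add_subgroup_def
  proof (intro conjI ballI)
    have "0 = int p *s 0 + (0 :: int ^ 'n)" by simp
    then show "0 \<in> W0" using add_subgroup_zero[OF subgroup] unfolding W0_def by blast
    fix x y assume "x \<in> W0" "y \<in> W0"
    then obtain x' l y' m where "x = int p *s x' + l" "y = int p *s y' + m" "l \<in> \<Lambda>" "m \<in> \<Lambda>"
      unfolding W0_def by blast
    moreover from this have "x - y = int p *s (x' - y') + (l - m)"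
      by (simp add: vector_ssub_ldistrib)
    ultimately show "x - y \<in> W0" using add_subgroup_diff[OF subgroup] unfolding W0_def by blast
  qed
  moreover have "\<Lambda> \<subseteq> W0"
  proof
    fix l assume "l \<in> \<Lambda>"
    moreover have "l = int p *s 0 + l" by simp
    ultimately show "l \<in> W0" unfolding W0_def by blast
  qed
  moreover have "int p *s x \<in> W0" for x
  proof -
    have "int p *s x = int p *s x + 0" by simp
    then show ?thesis using add_subgroup_zero[OF subgroup] unfolding W0_def by blast
  qed
  moreover have "W0 \<noteq> UNIV"
  proof
    assume W0: "W0 = UNIV"
    have "card U \<noteq> 0" using finite_U rep(1) by auto
    then obtain a q where aq: "card U = p ^ a * q" "\<not> p dvd q"
      by (metis multiplicity_decompose' p(1) not_prime_unit)
    \<comment> \<open>If \<open>W0\<close> were everything, each \<open>x\<close> would be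
      \<open>int p *s y\<close> modulo \<Lambda>, so one factor \<open>p\<close> could be stripped
      from any exponent of the quotient. What remains is the exponent \<open>q\<close>, prime to
      \<open>p\<close>, contradicting Cauchy.\<close>
    have "\<forall>x. int (p ^ b * q) *s x \<in> \<Lambda> \<Longrightarrow> \<forall>x. int q *s x \<in> \<Lambda>" for b
    proof (induction b)
      case 0
      then show ?case by simp
    next
      case (Suc b)
      have "int (p ^ b * q) *s x \<in> \<Lambda>" for x
      proof -
        obtain y l where yl: "x = int p *s y + l" "l \<in> \<Lambda>" using W0 unfolding W0_def by blast
        have "int (p ^ b * q) *s x = int (p ^ Suc b * q) *s y + int (p ^ b * q) *s l"
          unfolding yl(1) by (simp add: vector_add_ldistrib vector_smult_assoc mult_ac)
        then show ?thesis
          using Suc.prems add_subgroup_add[OF subgroup] add_subgroup_scale[OF subgroup yl(2)] by simp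
      qed
      then show ?case using Suc.IH by blast
    qed
    then have "\<forall>x. int q *s x \<in> \<Lambda>"
      using card_scale_mem_lattice aq(1) by metis
    moreover obtain r where "card U = r"
      "\<And>k s. (\<forall>x\<in>UNIV. int k *s x \<in> \<Lambda>) \<Longrightarrow> prime s \<Longrightarrow> s dvd r \<Longrightarrow> s dvd k"
      using index_exists[OF subgroup order_refl add_subgroup_UNIV] card_U_lattice by auto
    ultimately show False using p aq(2) by auto
  qed
  ultimately have ex: "?P W0" by blast
  have bd: "\<forall>W. ?P W \<longrightarrow> card (U \<inter> W) < Suc (card U)"
    using finite_U by (auto simp: less_Suc_eq_le intro!: card_mono)
  \<comment> \<open>Among the candidates take one with most representatives; a strictly larger
    subgroup has strictly more of them.\<close>
  obtain W where W: "?P W" "\<And>B. ?P B \<Longrightarrow> card (U \<inter> B) \<le> card (U \<inter> W)"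
    using ex_has_greatest_nat[of ?P W0 "\<lambda>W. card (U \<inter> W)" "Suc (card U)"] ex bd
    by (metis (no_types, lifting) less_imp_le)
  have "B = UNIV" if "add_subgroup B" "W \<subset> B" for B
  proof (rule ccontr)
    assume "B \<noteq> UNIV"
    then have "?P B" using that W(1) by blast
    then show False using W(2)[of B] card_less[of B W] that W(1) by auto
  qed
  then show thesis using that W(1) by blast
qed

end

section \<open>The shape of the tile\<close>

definition corner :: "'n set \<Rightarrow> int ^ 'n" where
  "corner A = (\<chi> i. if i \<in> A then -1 else 0)"

text \<open>Of the two neighbours of \<open>corner A\<close> in direction \<open>i\<close>, this is
  the one outside the cube of corners; the one inside is \<open>corner (toggle i A)\<close>.\<close>

definition spike :: "'n set \<Rightarrow> 'n \<Rightarrow> int ^ 'n" where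
  "spike A i = corner A + (if i \<in> A then - axis i 1 else axis i 1)"

definition toggle :: "'n \<Rightarrow> 'n set \<Rightarrow> 'n set" where
  "toggle i A = (if i \<in> A then A - {i} else insert i A)"

lemma corner_nth: "corner A $ i = (if i \<in> A then -1 else 0)"
  by (simp add: corner_def)

lemma spike_nth:
  "spike A i $ j = (if j = i then (if j \<in> A then -2 else 1) else if j \<in> A then -1 else 0)"
  by (simp add: spike_def corner_nth axis_def)

lemma corner_empty: "corner {} = 0"
  by (simp add: vec_eq_iff corner_nth)

lemma corner_insert: "i \<notin> A \<Longrightarrow> corner (insert i A) = corner A - axis i 1"
  by (auto simp: vec_eq_iff corner_nth axis_def)

lemma corner_toggle: "corner (toggle i A) = corner A - (if i \<in> A then - axis i 1 else axis i 1)"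
  by (auto simp: vec_eq_iff corner_nth axis_def toggle_def)

lemma inj_corner: "inj corner"
proof (rule injI)
  fix A B :: "'n::finite set" assume "corner A = corner B"
  then have "i \<in> A \<longleftrightarrow> i \<in> B" for i
    by (simp add: vec_eq_iff corner_nth split: if_splits) (metis neg_equal_0_iff_equal one_neq_zero)
  then show "A = B" by blast
qed

text \<open>The index \<open>i\<close> is the only coordinate outside -1 and 0, and \<open>A\<close>
  is the set of negative coordinates.\<close>

lemma inj_spike: "inj (\<lambda>(A, i). spike A i)"
proof (rule injI, clarsimp)
  fix A B :: "'n::finite set" and i j assume "spike A i = spike B j"
  then have *: "spike A i $ k = spike B j $ k" for k by simp
  have "i = j" using *[of i] by (auto simp: spike_nth split: if_splits)
  moreover have "k \<in> A \<longleftrightarrow> k \<in> B" for k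
    using *[of k] \<open>i = j\<close> by (auto simp: spike_nth split: if_splits)
  ultimately show "A = B \<and> i = j" by blast
qed

lemma corner_neq_spike: "corner A \<noteq> spike B i"
proof
  assume "corner A = spike B i"
  then have "corner A $ i = spike B i $ i" by simp
  then show False by (auto simp: spike_nth corner_nth split: if_splits)
qed

text \<open>Distance at most one allows only one coordinate to change, by one; the result is a spike
  or another corner. Listing the tile this way counts every point once.\<close>

lemma Upsilon_eq: "Upsilon = range corner \<union> range (\<lambda>(A, i). spike A i)"
proof (intro equalityI subsetI)
  fix x :: "int ^ 'n" assume "x \<in> Upsilon"
  then obtain X :: "int ^ 'n" where X: "\<And>i. X $ i \<in> {-1, 0}" "(\<Sum>i\<in>UNIV. \<bar>X $ i - x $ i\<bar>) \<le> 1"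
    unfolding Upsilon_def by blast
  define A where "A = {i. X $ i = -1}"
  have XA: "X = corner A" using X(1) by (auto simp: vec_eq_iff corner_nth A_def)
  show "x \<in> range corner \<union> range (\<lambda>(A, i). spike A i)"
  proof (cases "x = X")
    case True
    then show ?thesis using XA by blast
  next
    case False
    then obtain i where i: "x $ i \<noteq> X $ i" by (auto simp: vec_eq_iff)
    have sum: "(\<Sum>j\<in>UNIV. \<bar>X $ j - x $ j\<bar>) = \<bar>X $ i - x $ i\<bar> + (\<Sum>j\<in>UNIV - {i}. \<bar>X $ j - x $ j\<bar>)"
      by (rule sum.remove) auto
    have "(\<Sum>j\<in>UNIV - {i}. \<bar>X $ j - x $ j\<bar>) \<ge> 0" by (rule sum_nonneg) simp
    then have xi: "\<bar>X $ i - x $ i\<bar> = 1" and "(\<Sum>j\<in>UNIV - {i}. \<bar>X $ j - x $ j\<bar>) = 0"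
      using sum X(2) i by linarith+
    then have "\<forall>j\<in>UNIV - {i}. \<bar>X $ j - x $ j\<bar> = 0" by (subst (asm) sum_nonneg_eq_0_iff) auto
    then have xj: "x $ j = X $ j" if "j \<noteq> i" for j using that by force
    have "x $ i = spike A i $ i \<or> x $ i = corner (toggle i A) $ i"
      using xi unfolding XA by (auto simp: spike_nth corner_nth toggle_def)
    moreover have "x $ j = spike A i $ j \<and> x $ j = corner (toggle i A) $ j" if "j \<noteq> i" for j
      using xj[OF that] that unfolding XA by (auto simp: spike_nth corner_nth toggle_def)
    ultimately have "x = spike A i \<or> x = corner (toggle i A)"
      unfolding vec_eq_iff by metis
    then show ?thesis by auto
  qed
next
  fix x :: "int ^ 'n" assume "x \<in> range corner \<union> range (\<lambda>(A, i). spike A i)"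
  then consider A where "x = corner A" | A i where "x = spike A i" by auto
  then show "x \<in> Upsilon"
  proof cases
    case 1
    then show ?thesis
      unfolding Upsilon_def by (auto intro!: exI[of _ "corner A"] simp: corner_nth split: if_splits)
  next
    case 2
    have "(\<Sum>j\<in>UNIV. \<bar>corner A $ j - spike A i $ j\<bar>) = (\<Sum>j\<in>UNIV. if j = i then 1 else 0)"
      by (rule sum.cong) (auto simp: corner_nth spike_nth)
    then show ?thesis unfolding Upsilon_def 2
      by (auto intro!: exI[of _ "corner A"] simp: corner_nth split: if_splits)
  qed
qed

lemma sum_Upsilon:
  fixes f :: "int ^ 'n \<Rightarrow> int"
  shows "(\<Sum>u\<in>Upsilon. f u) = (\<Sum>A\<in>UNIV. f (corner A)) + (\<Sum>i\<in>UNIV. \<Sum>A\<in>UNIV. f (spike A i))"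
proof -
  have "(\<Sum>u\<in>Upsilon. f u) = (\<Sum>u\<in>range corner. f u) + (\<Sum>u\<in>range (\<lambda>(A, i). spike A i). f u)"
    unfolding Upsilon_eq by (rule sum.union_disjoint) (auto simp: corner_neq_spike corner_neq_spike[symmetric])
  also have "(\<Sum>u\<in>range corner. f u) = (\<Sum>A\<in>UNIV. f (corner A))"
    by (subst sum.reindex[OF inj_corner]) (simp add: o_def)
  also have "(\<Sum>u\<in>range (\<lambda>(A, i). spike A i). f u) = (\<Sum>(A, i)\<in>UNIV \<times> UNIV. f (spike A i))"
    by (subst sum.reindex[OF inj_spike]) (simp add: o_def case_prod_unfold)
  also have "\<dots> = (\<Sum>A\<in>UNIV. \<Sum>i\<in>UNIV. f (spike A i))"
    by (rule sum.cartesian_product[symmetric])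
  also have "\<dots> = (\<Sum>i\<in>UNIV. \<Sum>A\<in>UNIV. f (spike A i))" by (rule sum.swap)
  finally show ?thesis .
qed

lemma finite_Upsilon: "finite Upsilon"
  unfolding Upsilon_eq by simp

lemma card_Upsilon: "card (Upsilon :: (int ^ 'n) set) = 2 ^ CARD('n) * (CARD('n) + 1)"
proof -
  have "int (card (Upsilon :: (int ^ 'n) set)) = (\<Sum>u\<in>(Upsilon :: (int ^ 'n) set). 1)" by simp
  also have "\<dots> = int (2 ^ CARD('n) * (CARD('n) + 1))"
    unfolding sum_Upsilon by (simp add: card_UNIV_set algebra_simps)
  finally show ?thesis by (simp only: of_nat_eq_iff)
qed

text \<open>The neighbours of \<open>corner A\<close> in direction \<open>i\<close> are
  \<open>spike A i\<close> and \<open>corner (toggle i A)\<close>, and \<open>toggle i\<close>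
  permutes \<open>Pow J\<close>. It is used for \<open>J = UNIV\<close> to factor the tile sum, and
  later for the directions lying in \<open>W\<close>.\<close>

lemma sum_edges:
  fixes g :: "int ^ 'n \<Rightarrow> int"
  assumes "i \<in> J"
  shows "(\<Sum>A\<in>Pow J. g (corner A + axis i 1) + g (corner A - axis i 1)) =
    (\<Sum>A\<in>Pow J. g (spike A i)) + (\<Sum>A\<in>Pow J. g (corner A))"
proof -
  have "bij_betw (toggle i) (Pow J) (Pow J)"
    by (rule bij_betwI[of _ _ _ "toggle i"]) (use assms in \<open>auto simp: toggle_def split: if_splits\<close>)
  then have "(\<Sum>A\<in>Pow J. g (corner (toggle i A))) = (\<Sum>A\<in>Pow J. g (corner A))"
    by (rule sum.reindex_bij_betw)
  moreover have "g (corner A + axis i 1) + g (corner A - axis i 1) = g (spike A i) + g (corner (toggle i A))" for A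
    by (simp add: spike_def corner_toggle)
  ultimately show ?thesis by (simp add: sum.distrib)
qed

text \<open>The operator \<open>\<Prod>\<^sub>i (1 + S\<^sub>i\<^sup>-\<^sup>1)\<close> with
  \<open>i\<close> ranging over \<open>J\<close>, in expanded form.\<close>

definition cube_sum :: "'n set \<Rightarrow> (int ^ 'n \<Rightarrow> int) \<Rightarrow> int ^ 'n \<Rightarrow> int" where
  "cube_sum J g x = (\<Sum>A\<in>Pow J. g (x + corner A))"

lemma cube_sum_insert:
  fixes J :: "'n::finite set"
  assumes "i \<notin> J"
  shows "cube_sum (insert i J) g x = cube_sum J g x + cube_sum J g (x - axis i 1)"
proof -
  have inj: "inj_on (insert i) (Pow J)" using assms by (auto simp: inj_on_def)
  have "cube_sum (insert i J) g x = cube_sum J g x + (\<Sum>A\<in>insert i ` Pow J. g (x + corner A))"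
    unfolding cube_sum_def Pow_insert by (rule sum.union_disjoint) (use assms in auto)
  also have "(\<Sum>A\<in>insert i ` Pow J. g (x + corner A)) = (\<Sum>A\<in>Pow J. g (x + corner (insert i A)))"
    by (subst sum.reindex[OF inj]) (simp add: o_def)
  also have "\<dots> = cube_sum J g (x - axis i 1)"
    unfolding cube_sum_def
  proof (rule sum.cong[OF refl])
    fix A assume "A \<in> Pow J"
    then have "corner (insert i A) = corner A - axis i 1" using assms corner_insert[of i A] by blast
    then have "x + corner (insert i A) = x - axis i 1 + corner A" by (simp only: algebra_simps)
    then show "g (x + corner (insert i A)) = g (x - axis i 1 + corner A)" by (simp only:)
  qed
  finally show ?thesis .
qed

section \<open>Inverting factors of the cube sum\<close>

text \<open>A linear, translation-invariant condition, hence inherited by every combination of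
  translates of \<open>g\<close>. It makes the factor \<open>1 + S\<^sub>i\<^sup>-\<^sup>1\<close>
  injective when \<open>q\<close> is even.\<close>

definition cancels :: "nat \<Rightarrow> nat \<Rightarrow> 'n \<Rightarrow> (int ^ 'n \<Rightarrow> int) \<Rightarrow> bool" where
  "cancels p q i g \<longleftrightarrow> (\<forall>x. (\<Sum>c<p. g (x + int (c * q) *s axis i 1)) = 0)"

lemma cancels_sum:
  assumes "\<And>a. a \<in> S \<Longrightarrow> cancels p q i (g a)"
  shows "cancels p q i (\<lambda>x. \<Sum>a\<in>S. g a x)"
  unfolding cancels_def
proof
  fix x
  have "(\<Sum>c<p. \<Sum>a\<in>S. g a (x + int (c * q) *s axis i 1)) =
      (\<Sum>a\<in>S. \<Sum>c<p. g a (x + int (c * q) *s axis i 1))" by (rule sum.swap)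
  also have "\<dots> = 0" using assms by (simp add: cancels_def)
  finally show "(\<Sum>c<p. \<Sum>a\<in>S. g a (x + int (c * q) *s axis i 1)) = 0" .
qed

lemma cancels_translate:
  assumes "cancels p q i g"
  shows "cancels p q i (\<lambda>x. g (x + y))"
  unfolding cancels_def
proof
  fix x
  have "(\<Sum>c<p. g ((x + y) + int (c * q) *s axis i 1)) = 0" using assms unfolding cancels_def by blast
  then show "(\<Sum>c<p. g (x + int (c * q) *s axis i 1 + y)) = 0" by (simp add: ac_simps)
qed

text \<open>Changing sign under a unit step gives period 2, hence period \<open>q\<close> because
  \<open>q\<close> is even. The \<open>p\<close> cancelling values are then all equal, and so
  zero.\<close>

lemma cancels_antiperiodic:
  fixes g :: "int ^ 'n \<Rightarrow> int"
  assumes "cancels p q i g" "p > 0" "even q" "\<And>x. g x + g (x - axis i 1) = 0"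
  shows "g x = 0"
proof -
  have two: "g (y + int (2 * m) *s axis i 1) = g y" for y m
  proof (induction m)
    case (Suc m)
    let ?z = "y + int (2 * m) *s axis i 1"
    have "y + int (2 * Suc m) *s axis i 1 = ?z + axis i 1 + axis i 1"
      by (simp add: vec_eq_iff algebra_simps)
    moreover have "g (?z + axis i 1) + g ?z = 0" "g (?z + axis i 1 + axis i 1) + g (?z + axis i 1) = 0"
      using assms(4)[of "?z + axis i 1"] assms(4)[of "?z + axis i 1 + axis i 1"]
      by (simp_all only: add_diff_cancel_right')
    ultimately show ?case using Suc.IH by (simp only:)
  qed simp
  have "g (x + int (c * q) *s axis i 1) = g x" for c
  proof -
    have "c * q = 2 * (c * (q div 2))" using assms(3) by auto
    then show ?thesis using two[of x "c * (q div 2)"] by (simp only:)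
  qed
  then have "(\<Sum>c<p. g x) = 0" using assms(1)[unfolded cancels_def, rule_format, of x] by (simp only:)
  then show ?thesis using assms(2) by simp
qed

text \<open>The factors outside \<open>J\<close> are removed one by one: a vanishing product with
  the factor for \<open>i\<close> says that the remaining cube sum is antiperiodic in direction
  \<open>i\<close>.\<close>

lemma cube_sum_strip:
  fixes h :: "int ^ 'n \<Rightarrow> int"
  assumes "\<And>i. i \<notin> J \<Longrightarrow> cancels p q i h" "p > 0" "even q" "\<And>x. cube_sum UNIV h x = 0"
  shows "cube_sum J h x = 0"
proof -
  have "\<forall>x. cube_sum J h x = 0" if "finite K" "K \<inter> J = {}" "\<forall>x. cube_sum (J \<union> K) h x = 0" for K
    using that
  proof (induction K rule: finite_induct)
    case (insert i K)
    have "cancels p q i (cube_sum (J \<union> K) h)"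
      unfolding cube_sum_def using insert.prems assms(1)
      by (intro cancels_sum cancels_translate) auto
    moreover have "cube_sum (J \<union> K) h x + cube_sum (J \<union> K) h (x - axis i 1) = 0" for x
      using insert.prems insert.hyps cube_sum_insert[of i "J \<union> K" h x] by simp
    ultimately have "cube_sum (J \<union> K) h x = 0" for x
      using cancels_antiperiodic assms(2,3) by blast
    then show ?case using insert by blast
  qed simp
  from this[of "- J"] show ?thesis using assms(4) by simp
qed

section \<open>Consequences of the tiling property\<close>

text \<open>By maximality the class of \<open>int q *s v\<close> generates the quotient by
  \<open>W\<close>, and this class has order \<open>p\<close>, so the \<open>p\<close> shifts of
  \<open>x\<close> meet every coset of \<open>W\<close> once.\<close>

lemma maximal_subgroup_unique_shift:
  assumes W: "add_subgroup W" "\<And>x. int p *s x \<in> W" "\<And>B. add_subgroup B \<Longrightarrow> W \<subset> B \<Longrightarrow> B = UNIV"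
    and p: "prime p" "coprime p q" and v: "v \<notin> W"
  shows "\<exists>!c. c < p \<and> x + int (c * q) *s v \<in> W"
proof -
  have p0: "p > 0" using p(1) by (simp add: prime_gt_0_nat)
  let ?v = "int q *s v"
  have "?v \<notin> W"
    using add_subgroup_coprime_scale[OF W(1) _ W(2), of "int q" v] p(2) v by (auto simp: coprime_commute)
  then have "adjoin W ?v = UNIV"
    using W(3)[OF add_subgroup_adjoin[OF W(1)]] adjoin_superset adjoin_generator[OF W(1)] by blast
  then obtain b k where bk: "x = b + k *s ?v" "b \<in> W" unfolding adjoin_def by blast
  \<comment> \<open>The residue of \<open>- k\<close>, so that \<open>k + int c\<close> is a
    multiple of \<open>p\<close>.\<close>
  define c where "c = nat ((- k) mod int p)"
  have c: "int c = (- k) mod int p" "c < p" using p0 by (simp_all add: c_def nat_less_iff)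
  have "int p dvd k + int c" unfolding c by (simp add: mod_add_right_eq dvd_eq_mod_eq_0)
  then obtain m where m: "k + int c = int p * m" by blast
  have "x + int (c * q) *s v = b + (k + int c) *s ?v"
    unfolding bk by (simp add: vec_eq_iff algebra_simps)
  also have "\<dots> = b + int p *s (m *s ?v)" unfolding m by (simp only: vector_smult_assoc mult.assoc)
  also have "\<dots> \<in> W" by (rule add_subgroup_add[OF W(1) bk(2) W(2)])
  finally have "c < p \<and> x + int (c * q) *s v \<in> W" using c by blast
  moreover have "c = d" if "c < p" "d < p" "x + int (c * q) *s v \<in> W" "x + int (d * q) *s v \<in> W" for c d
  proof -
    have "(int (c * q) - int (d * q)) *s v = (x + int (c * q) *s v) - (x + int (d * q) *s v)"
      by (simp add: vector_sub_rdistrib)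
    also have "\<dots> \<in> W" by (rule add_subgroup_diff[OF W(1) that(3,4)])
    finally have "(int (c * q) - int (d * q)) *s v \<in> W" .
    then have "\<not> coprime (int (c * q) - int (d * q)) (int p)"
      using add_subgroup_coprime_scale[OF W(1) _ W(2)] v by blast
    then have "int p dvd int (c * q) - int (d * q)"
      using p(1) prime_imp_coprime[of "int p" "int (c * q) - int (d * q)"] by (auto simp: coprime_commute)
    then have "int p dvd (int c - int d) * int q" by (simp add: algebra_simps)
    then have "int p dvd int c - int d" using p(2) by (simp add: coprime_dvd_mult_left_iff)
    then show ?thesis using dvd_imp_le_int[of "int c - int d" "int p"] that(1,2) by linarith
  qed
  ultimately show ?thesis by blast
qed

text \<open>If \<open>W\<close> has index \<open>p\<close>, this is the sum of the nontrivial characters modulo \<open>W\<close>.\<close>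

definition character_sum :: "nat \<Rightarrow> (int ^ 'n) set \<Rightarrow> int ^ 'n \<Rightarrow> int" where
  "character_sum p W x = (if x \<in> W then int p - 1 else -1)"

text \<open>Exactly one shift lands in \<open>W\<close> and contributes \<open>p - 1\<close>; each
  of the other \<open>p - 1\<close> contributes -1.\<close>

lemma sum_character_sum:
  assumes "add_subgroup W" "\<And>x. int p *s x \<in> W" "\<And>B. add_subgroup B \<Longrightarrow> W \<subset> B \<Longrightarrow> B = UNIV"
    and "prime p" "coprime p q" "v \<notin> W"
  shows "(\<Sum>c<p. character_sum p W (x + int (c * q) *s v)) = 0"
proof -
  let ?P = "\<lambda>c. c < p \<and> x + int (c * q) *s v \<in> W"
  have ex1: "\<exists>!c. ?P c" by (rule maximal_subgroup_unique_shift[OF assms])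
  then obtain d where d: "?P d" by blast
  have "(\<Sum>c<p. character_sum p W (x + int (c * q) *s v)) = (\<Sum>c<p. (if c = d then int p else 0) - 1)"
  proof (rule sum.cong[OF refl])
    fix c assume "c \<in> {..<p}"
    then have "x + int (c * q) *s v \<in> W \<longleftrightarrow> c = d" using ex1 d by blast
    then show "character_sum p W (x + int (c * q) *s v) = (if c = d then int p else 0) - 1"
      by (simp only: character_sum_def split: if_split) simp
  qed
  also have "\<dots> = 0" using d by (simp add: sum_subtractf)
  finally show ?thesis .
qed

section \<open>Factoring the sum over the tile\<close>

definition half_cross :: "(int ^ 'n \<Rightarrow> int) \<Rightarrow> int ^ 'n \<Rightarrow> int" where
  "half_cross f x = (\<Sum>i\<in>UNIV. f (x + axis i 1) + f (x - axis i 1)) - (int CARD('n) - 1) * f x"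

text \<open>By \<open>sum_edges\<close>, neighbours in one direction produce the spikes of that
  direction and all corners once. Over all \<open>n\<close> directions the corners occur
  \<open>n\<close> times instead of once, whence the correction \<open>n - 1\<close> in
  \<open>half_cross\<close>, which is the operator \<open>M\<close>.\<close>

lemma sum_Upsilon_factor:
  fixes f :: "int ^ 'n \<Rightarrow> int"
  shows "(\<Sum>u\<in>Upsilon. f (x + u)) = cube_sum UNIV (half_cross f) x"
proof -
  have "(\<Sum>A\<in>UNIV. f (x + corner A + axis i 1) + f (x + corner A - axis i 1)) =
      (\<Sum>A\<in>UNIV. f (x + spike A i)) + (\<Sum>A\<in>UNIV. f (x + corner A))" for i
    using sum_edges[of i UNIV "\<lambda>y. f (x + y)"] by (simp add: add.assoc add_diff_eq)
  then have "(\<Sum>A\<in>UNIV. \<Sum>i\<in>UNIV. f (x + corner A + axis i 1) + f (x + corner A - axis i 1)) =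
      (\<Sum>i\<in>UNIV. \<Sum>A\<in>UNIV. f (x + spike A i)) + int CARD('n) * (\<Sum>A\<in>UNIV. f (x + corner A))"
    by (subst sum.swap) (simp add: sum.distrib)
  moreover have "cube_sum UNIV (half_cross f) x =
      (\<Sum>A\<in>UNIV. \<Sum>i\<in>UNIV. f (x + corner A + axis i 1) + f (x + corner A - axis i 1)) -
      (int CARD('n) - 1) * (\<Sum>A\<in>UNIV. f (x + corner A))"
    by (simp only: cube_sum_def half_cross_def Pow_UNIV sum_subtractf sum_distrib_left)
  ultimately show ?thesis
    unfolding sum_Upsilon by (simp add: left_diff_distrib)
qed

lemma cancels_half_cross:
  assumes "cancels p q i f"
  shows "cancels p q i (half_cross f)"
proof -
  have shift: "(\<Sum>c<p. f (x + int (c * q) *s axis i 1 + y)) = 0" for x y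
    using cancels_translate[OF assms, of y] unfolding cancels_def by blast
  have shift': "(\<Sum>c<p. f (x + int (c * q) *s axis i 1 - y)) = 0" for x y
    using shift[of x "- y"] by simp
  have "(\<Sum>c<p. \<Sum>j\<in>UNIV. f (x + int (c * q) *s axis i 1 + axis j 1) +
      f (x + int (c * q) *s axis i 1 - axis j 1)) = 0" for x
    by (subst sum.swap) (simp only: sum.distrib shift shift' sum.neutral_const add_0)
  moreover have "(\<Sum>c<p. f (x + int (c * q) *s axis i 1)) = 0" for x
    using assms unfolding cancels_def by blast
  ultimately show ?thesis
    unfolding cancels_def half_cross_def
    by (simp only: sum_subtractf sum_distrib_left[symmetric]) simp
qed

lemma corner_mem_subgroup:
  assumes W: "add_subgroup W" and "\<And>i. i \<in> A \<Longrightarrow> axis i 1 \<in> W"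
  shows "corner A \<in> W"
proof -
  have "finite A" by simp
  then show ?thesis using assms(2)
  proof (induction A rule: finite_induct)
    case empty
    then show ?case by (simp add: corner_empty add_subgroup_zero[OF W])
  next
    case (insert i A)
    then show ?case by (simp add: corner_insert add_subgroup_diff[OF W])
  qed
qed

lemma spike_mem_subgroup:
  assumes W: "add_subgroup W" and "\<And>j. j \<in> A \<Longrightarrow> axis j 1 \<in> W" "axis i 1 \<in> W"
  shows "spike A i \<in> W"
  using corner_mem_subgroup[OF assms(1,2)] assms(3) add_subgroup_add[OF W] add_subgroup_diff[OF W]
  by (simp add: spike_def)

text \<open>This is the stripped equation evaluated at the origin. Corners and spikes built from
  \<open>J\<close> lie in \<open>W\<close> and carry weight \<open>p - 1\<close>; neighbours in the
  other directions lie off \<open>W\<close> and carry -1. \<open>L\<close> stays general because two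
  choices are needed.\<close>

lemma tiling_identity:
  fixes \<Lambda> W L :: "(int ^ 'n) set"
  assumes tiling: "lattice_transversal \<Lambda> Upsilon"
    and W: "add_subgroup W" "\<Lambda> \<subseteq> W" "\<And>x. int p *s x \<in> W"
      "\<And>B. add_subgroup B \<Longrightarrow> W \<subset> B \<Longrightarrow> B = UNIV" "W \<noteq> UNIV"
    and p: "prime p" "coprime p q" "even q"
    and L: "add_subgroup L" "\<Lambda> \<subseteq> L" "\<And>x. int q *s x \<in> L"
  defines "J \<equiv> {i. axis i 1 \<in> W}"
    and "l \<equiv> \<lambda>x. if x \<in> L then 1 else (0 :: int)"
  shows "(int p - 1) * ((\<Sum>i\<in>J. \<Sum>A\<in>Pow J. l (spike A i)) +
      (int (card J) - int CARD('n) + 1) * (\<Sum>A\<in>Pow J. l (corner A))) =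
    (\<Sum>i\<in>-J. \<Sum>A\<in>Pow J. l (corner A + axis i 1) + l (corner A - axis i 1))"
proof -
  interpret lattice_transversal \<Lambda> Upsilon by (rule tiling)
  define f where "f x = character_sum p W x * l x" for x
  have p0: "p > 0" using p(1) by (simp add: prime_gt_0_nat)
  have periodic: "f (x + y) = f x" if "y \<in> \<Lambda>" for x y
    using add_subgroup_cancel(1)[OF W(1), of y x] add_subgroup_cancel(1)[OF L(1), of y x] that W(2) L(2)
    by (auto simp: f_def character_sum_def l_def)
  have f_cancels: "cancels p q i f" if "i \<notin> J" for i
    unfolding cancels_def
  proof
    fix x
    have "int (c * q) *s axis i 1 = int c *s (int q *s axis i 1)" for c
      by (simp add: vector_smult_assoc)
    \<comment> \<open>The shifts lie in \<open>L\<close>, so the indicator of \<open>L\<close> is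
      constant along them and factors out of the character sum.\<close>
    then have "l (x + int (c * q) *s axis i 1) = l x" for c
      using add_subgroup_cancel(1)[OF L(1) add_subgroup_scale[OF L(1) L(3)]]
      by (simp only: l_def)
    then have "(\<Sum>c<p. f (x + int (c * q) *s axis i 1)) =
        (\<Sum>c<p. character_sum p W (x + int (c * q) *s axis i 1)) * l x"
      by (simp only: f_def sum_distrib_right)
    also have "\<dots> = 0"
      using sum_character_sum[OF W(1,3,4) p(1,2), of "axis i 1" x] that by (simp add: J_def)
    finally show "(\<Sum>c<p. f (x + int (c * q) *s axis i 1)) = 0" .
  qed
  have "J \<noteq> UNIV"
  proof
    assume J: "J = UNIV"
    have "x \<in> W" for x
    proof -
      have "x = (\<Sum>i\<in>UNIV. x $ i *s axis i 1)"
        by (simp add: vec_eq_iff axis_def if_distrib[of "\<lambda>y. _ * y"] cong: if_cong)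
      also have "\<dots> \<in> W"
        using J by (intro add_subgroup_sum[OF W(1)] add_subgroup_scale[OF W(1)]) (auto simp: J_def)
      finally show ?thesis .
    qed
    then show False using W(5) by blast
  qed
  then obtain k where k: "k \<notin> J" by blast
  \<comment> \<open>The tile sum of a periodic function is constant in \<open>x\<close>, and it
    cancels in the direction \<open>k\<close> outside \<open>J\<close>; hence \<open>p\<close> times
    the constant is zero.\<close>
  have tile_sum: "(\<Sum>u\<in>Upsilon. f (x + u)) = 0" for x
  proof -
    have const: "(\<Sum>u\<in>Upsilon. f (y + u)) = (\<Sum>u\<in>Upsilon. f u)" for y
      by (rule sum_translate) (rule periodic)
    have "cancels p q k (\<lambda>x. \<Sum>u\<in>Upsilon. f (x + u))"
      by (intro cancels_sum cancels_translate f_cancels k)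
    then have "int p * (\<Sum>u\<in>Upsilon. f u) = 0"
      unfolding cancels_def const by simp
    then show ?thesis using p0 by (simp add: const)
  qed
  have "cube_sum J (half_cross f) 0 = 0"
  proof (rule cube_sum_strip[where p = p and q = q])
    show "cube_sum UNIV (half_cross f) x = 0" for x
      using tile_sum[of x] sum_Upsilon_factor[of f x] by simp
  qed (auto intro: cancels_half_cross f_cancels p p0)
  then have eq: "(\<Sum>i\<in>UNIV. \<Sum>A\<in>Pow J. f (corner A + axis i 1) + f (corner A - axis i 1)) =
      (int CARD('n) - 1) * (\<Sum>A\<in>Pow J. f (corner A))"
    unfolding cube_sum_def half_cross_def
    by (subst sum.swap) (simp add: sum_subtractf sum_distrib_left)
  have corner: "corner A \<in> W" if "A \<in> Pow J" for A
    using that by (intro corner_mem_subgroup[OF W(1)]) (auto simp: J_def)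
  have f_corner: "f (corner A) = (int p - 1) * l (corner A)" if "A \<in> Pow J" for A
    using corner[OF that] by (simp add: f_def character_sum_def)
  have f_spike: "f (spike A i) = (int p - 1) * l (spike A i)" if "A \<in> Pow J" "i \<in> J" for A i
    using spike_mem_subgroup[OF W(1), of A i] that by (auto simp: f_def character_sum_def J_def)
  have f_off: "f (corner A + axis i 1) + f (corner A - axis i 1) =
      - (l (corner A + axis i 1) + l (corner A - axis i 1))" if "A \<in> Pow J" "i \<notin> J" for A i
    using add_subgroup_cancel(2)[OF W(1) corner[OF that(1)], of "axis i 1"]
      add_subgroup_cancel(2)[OF W(1) corner[OF that(1)], of "- axis i 1"]
      add_subgroup_uminus[OF W(1), of "- axis i 1"] that(2)
    by (auto simp: f_def character_sum_def J_def)
  have on: "(\<Sum>i\<in>J. \<Sum>A\<in>Pow J. f (corner A + axis i 1) + f (corner A - axis i 1)) =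
      (int p - 1) * ((\<Sum>i\<in>J. \<Sum>A\<in>Pow J. l (spike A i)) + int (card J) * (\<Sum>A\<in>Pow J. l (corner A)))"
  proof -
    have "(\<Sum>A\<in>Pow J. f (corner A + axis i 1) + f (corner A - axis i 1)) =
        (int p - 1) * (\<Sum>A\<in>Pow J. l (spike A i)) + (int p - 1) * (\<Sum>A\<in>Pow J. l (corner A))"
      if "i \<in> J" for i
      using that f_corner f_spike by (simp add: sum_edges sum_distrib_left)
    then have "(\<Sum>i\<in>J. \<Sum>A\<in>Pow J. f (corner A + axis i 1) + f (corner A - axis i 1)) =
        (\<Sum>i\<in>J. (int p - 1) * (\<Sum>A\<in>Pow J. l (spike A i)) + (int p - 1) * (\<Sum>A\<in>Pow J. l (corner A)))"
      by (rule sum.cong[OF refl])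
    also have "\<dots> = (int p - 1) * (\<Sum>i\<in>J. \<Sum>A\<in>Pow J. l (spike A i)) +
        int (card J) * ((int p - 1) * (\<Sum>A\<in>Pow J. l (corner A)))"
      by (simp only: sum.distrib sum_constant sum_distrib_left[symmetric])
    finally show ?thesis by (simp add: algebra_simps)
  qed
  have off: "(\<Sum>i\<in>-J. \<Sum>A\<in>Pow J. f (corner A + axis i 1) + f (corner A - axis i 1)) =
      - (\<Sum>i\<in>-J. \<Sum>A\<in>Pow J. l (corner A + axis i 1) + l (corner A - axis i 1))"
    unfolding sum_negf[symmetric] by (intro sum.cong refl f_off) auto
  have split: "(\<Sum>i\<in>UNIV. h i) = (\<Sum>i\<in>J. h i) + (\<Sum>i\<in>-J. h i)" for h :: "'n \<Rightarrow> int"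
    using sum.union_disjoint[of J "- J" h] by simp
  have total: "(\<Sum>A\<in>Pow J. f (corner A)) = (int p - 1) * (\<Sum>A\<in>Pow J. l (corner A))"
    unfolding sum_distrib_left by (intro sum.cong refl f_corner)
  then show ?thesis
    using eq unfolding split on off total by (simp add: algebra_simps)
qed

text \<open>One instance of \<open>tiling_identity\<close> determines \<open>e\<close> exactly, the
  other yields \<open>p * e \<le> p ^ a\<close>; together they leave only \<open>p = 3\<close> and
  cofactor 1.\<close>

lemma tiling_odd_prime:
  fixes \<Lambda> :: "(int ^ 'n) set"
  assumes tiling: "lattice_transversal \<Lambda> Upsilon"
    and p: "prime p" "odd p" "p dvd CARD('n) + 1"
  shows "\<exists>a>0. CARD('n) + 1 = 3 ^ a"
proof -
  interpret lattice_transversal \<Lambda> Upsilon by (rule tiling)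
  define n where "n = CARD('n)"
  have n: "n > 0" by (simp add: n_def)
  obtain a q' where q': "n + 1 = p ^ a * q'" "\<not> p dvd q'"
  proof (rule multiplicity_decompose'[of "n + 1" p])
    show "\<not> is_unit p" using p(1) not_prime_unit by blast
  qed simp_all
  have a: "a > 0" using q' p(3) by (cases a) (auto simp: n_def)
  \<comment> \<open>The part of \<open>card Upsilon\<close> prime to \<open>p\<close>; it is even
    because \<open>n > 0\<close>.\<close>
  define q where "q = 2 ^ n * q'"
  have card: "card (Upsilon :: (int ^ 'n) set) = p ^ a * q"
    unfolding card_Upsilon using q'(1) by (simp add: q_def n_def)
  have "\<not> p dvd 2 ^ n"
    using p(1,2) prime_dvd_power[of p 2 n] primes_dvd_imp_eq[OF p(1) two_is_prime_nat] by auto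
  then have pq: "\<not> p dvd q" using p(1) q'(2) by (simp add: q_def prime_dvd_mult_iff)
  have q: "coprime p q" "even q"
    using pq p(1) n by (simp_all add: prime_imp_coprime) (simp add: q_def)
  obtain W where W: "add_subgroup W" "\<Lambda> \<subseteq> W" "\<And>x. int p *s x \<in> W" "W \<noteq> UNIV"
    "\<And>B. add_subgroup B \<Longrightarrow> W \<subset> B \<Longrightarrow> B = UNIV"
    by (rule maximal_subgroup_exists[OF p(1)]) (use card a in auto)
  define J where "J = {i. axis i 1 \<in> W}"
  define e where "e = card (- J)"
  have J_card: "card J + e = n"
    using card_Un_disjoint[of J "- J"] by (simp add: e_def n_def)
  have identity: "(int p - 1) * ((\<Sum>i\<in>J. \<Sum>A\<in>Pow J. if spike A i \<in> L then 1 else 0) +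
      (1 - int e) * (\<Sum>A\<in>Pow J. if corner A \<in> L then 1 else 0)) =
    (\<Sum>i\<in>-J. \<Sum>A\<in>Pow J. (if corner A + axis i 1 \<in> L then 1 else 0) +
      (if corner A - axis i 1 \<in> L then 1 else 0))"
    if "add_subgroup L" "\<Lambda> \<subseteq> L" "\<And>x. int q *s x \<in> L" for L
    using tiling_identity[OF tiling W(1-3,5,4) p(1) q that, folded J_def n_def] J_card
    by (simp add: algebra_simps flip: J_card)
  \<comment> \<open>With \<open>L = UNIV\<close> every indicator is 1, and the common factor
    \<open>2 ^ card J\<close> can be divided out.\<close>
  have "(int p - 1) * (int (card J) * 2 ^ card J + (1 - int e) * 2 ^ card J) = int e * 2 * 2 ^ card J"
    using identity[OF add_subgroup_UNIV] by (simp add: card_Pow e_def)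
  then have "((int p - 1) * (int (card J) + 1 - int e)) * 2 ^ card J = (2 * int e) * 2 ^ card J"
    by (simp add: algebra_simps)
  then have "(int p - 1) * (int (card J) + 1 - int e) = 2 * int e" by simp
  then have e: "2 * int e * int p = (int p - 1) * (int n + 1)"
    using J_card by (simp add: algebra_simps flip: J_card)

  \<comment> \<open>The second choice of \<open>L\<close>: modulo \<Lambda> this is the
    \<open>p\<close>-part of the quotient.\<close>
  define L where "L = {x. int (p ^ a) *s x \<in> \<Lambda>}"
  have L: "add_subgroup L" "\<Lambda> \<subseteq> L" "int q *s x \<in> L" for x
    using add_subgroup_torsion[OF subgroup] add_subgroup_scale[OF subgroup] card_scale_mem_lattice[of x]
    by (auto simp: L_def vector_smult_assoc card)
  let ?E = "\<Sum>A\<in>Pow J. if corner A \<in> L then 1 else (0 :: int)"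
  let ?O = "\<Sum>i\<in>J. \<Sum>A\<in>Pow J. if spike A i \<in> L then 1 else (0 :: int)"
  have "?E \<ge> (\<Sum>A\<in>{{}}. if corner A \<in> L then 1 else (0 :: int))"
    by (intro sum_mono2) auto
  then have E: "?E \<ge> 1" by (simp add: corner_empty add_subgroup_zero[OF L(1)])
  \<comment> \<open>The right side of the identity counts points, so it is nonnegative. With
    \<open>?E \<ge> 1\<close>, supplied by the origin, this gives
    \<open>?O + ?E \<ge> int e\<close>.\<close>
  have "(int p - 1) * (?O + (1 - int e) * ?E) \<ge> 0"
    unfolding identity[OF L] by (intro sum_nonneg) auto
  then have "?O + (1 - int e) * ?E \<ge> 0"
    using prime_gt_1_nat[OF p(1)] by (simp add: zero_le_mult_iff)
  then have "?O + ?E \<ge> int e * ?E" by (simp add: algebra_simps)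
  moreover have "int e * ?E \<ge> int e * 1" using E by (intro mult_left_mono) auto
  moreover have "?O + ?E \<le> int (card (Upsilon \<inter> (L \<inter> W)))"
  proof -
    have "?E + ?O \<le> (\<Sum>A\<in>UNIV. if corner A \<in> L \<inter> W then 1 else (0 :: int)) +
        (\<Sum>i\<in>UNIV. \<Sum>A\<in>UNIV. if spike A i \<in> L \<inter> W then 1 else (0 :: int))"
    proof (intro add_mono)
      have "?E = (\<Sum>A\<in>Pow J. if corner A \<in> L \<inter> W then 1 else (0 :: int))"
        using corner_mem_subgroup[OF W(1)] by (intro sum.cong) (auto simp: J_def)
      also have "\<dots> \<le> (\<Sum>A\<in>UNIV. if corner A \<in> L \<inter> W then 1 else (0 :: int))"
        by (intro sum_mono2) auto
      finally show "?E \<le> (\<Sum>A\<in>UNIV. if corner A \<in> L \<inter> W then 1 else (0 :: int))" .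
      have "?O = (\<Sum>i\<in>J. \<Sum>A\<in>Pow J. if spike A i \<in> L \<inter> W then 1 else (0 :: int))"
        using spike_mem_subgroup[OF W(1)] by (intro sum.cong) (auto simp: J_def)
      also have "\<dots> \<le> (\<Sum>i\<in>J. \<Sum>A\<in>UNIV. if spike A i \<in> L \<inter> W then 1 else (0 :: int))"
        by (intro sum_mono sum_mono2) auto
      also have "\<dots> \<le> (\<Sum>i\<in>UNIV. \<Sum>A\<in>UNIV. if spike A i \<in> L \<inter> W then 1 else (0 :: int))"
        by (intro sum_mono2) (auto intro: sum_nonneg)
      finally show "?O \<le> (\<Sum>i\<in>UNIV. \<Sum>A\<in>UNIV. if spike A i \<in> L \<inter> W then 1 else (0 :: int))" .
    qed
    also have "\<dots> = (\<Sum>u\<in>Upsilon. if u \<in> L \<inter> W then 1 else 0)"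
      by (rule sum_Upsilon[symmetric])
    also have "\<dots> = int (card (Upsilon \<inter> (L \<inter> W)))"
      by (subst sum.If_cases[OF finite_U]) (simp add: Int_def)
    finally show ?thesis by simp
  qed
  ultimately have e_le: "e \<le> card (Upsilon \<inter> (L \<inter> W))" by linarith

  have "card (Upsilon \<inter> L) dvd p ^ a"
    unfolding L_def by (rule card_torsion_dvd[OF p(1) card pq])
  then have card_L: "card (Upsilon \<inter> L) \<le> p ^ a"
    using prime_gt_0_nat[OF p(1)] by (intro dvd_imp_le) auto
  have LW: "add_subgroup (L \<inter> W)" "\<Lambda> \<subseteq> L \<inter> W"
    using add_subgroup_Int L W by auto
  \<comment> \<open>\<open>r\<close> is the index of \<open>L \<inter> W\<close> in
    \<open>L\<close>. It is not 1, since \<open>int q *s v\<close> lies in \<open>L\<close> but not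
    in \<open>W\<close>, and its only possible prime divisor is \<open>p\<close>; hence
    \<open>p \<le> r\<close>.\<close>
  obtain r where r: "card (Upsilon \<inter> L) = r * card (Upsilon \<inter> (L \<inter> W))"
    "\<And>k s. (\<forall>x\<in>L. int k *s x \<in> L \<inter> W) \<Longrightarrow> prime s \<Longrightarrow> s dvd r \<Longrightarrow> s dvd k"
    using index_exists[OF LW L(1)] by blast
  obtain v where "v \<notin> W" using W(4) by blast
  then have "int q *s v \<notin> W"
    using add_subgroup_coprime_scale[OF W(1) _ W(3), of "int q" v] q(1) by (auto simp: coprime_commute)
  then have "L \<inter> W \<subset> L" using L(3)[of v] by blast
  then have lt: "card (Upsilon \<inter> (L \<inter> W)) < card (Upsilon \<inter> L)"
    using card_less L(1) LW by blast
  then have "r \<noteq> 1" using r(1) by auto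
  then obtain s where s: "prime s" "s dvd r" using prime_factor_nat by blast
  have "\<forall>x\<in>L. int p *s x \<in> L \<inter> W" using W(3) add_subgroup_scale[OF L(1)] by blast
  then have "s dvd p" using r(2) s by blast
  then have "p dvd r" using s p(1) primes_dvd_imp_eq by blast
  moreover have "r > 0" using r(1) lt by (cases r) auto
  ultimately have "p \<le> r" by (rule dvd_imp_le)
  then have "p * e \<le> r * card (Upsilon \<inter> (L \<inter> W))" using e_le by (rule mult_le_mono)
  then have pe: "p * e \<le> p ^ a" using r(1) card_L by simp

  \<comment> \<open>\<open>p'\<close> stands for \<open>p - 1\<close>. The two relations for
    \<open>e\<close> combine to \<open>p' * q' \<le> 2\<close>, while \<open>p' \<ge> 2\<close> as
    \<open>p\<close> is odd.\<close>
  obtain p' where p': "p = Suc p'" using prime_gt_0_nat[OF p(1)] by (cases p) auto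
  have "int (2 * (p * e)) = (int p - 1) * int (n + 1)" using e by (simp add: ac_simps)
  also have "\<dots> = int (p' * (p ^ a * q'))" unfolding q'(1) p' by simp
  finally have "2 * (p * e) = p' * (p ^ a * q')" by (simp only: of_nat_eq_iff)
  then have "p' * (p ^ a * q') \<le> 2 * p ^ a" using pe by linarith
  then have "(p' * q') * p ^ a \<le> 2 * p ^ a" by (simp add: ac_simps)
  then have le2: "p' * q' \<le> 2" using prime_gt_0_nat[OF p(1)] by (simp only: mult_le_cancel2) simp
  have "p > 2" using p(1,2) prime_ge_2_nat[of p] by (cases "p = 2") auto
  then have p'2: "p' \<ge> 2" using p' by simp
  have "q' > 0" using q'(2) by (cases q') auto
  then have "p' \<le> p' * q'" by simp
  then have "p' = 2" using le2 p'2 by linarith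
  then have "p = 3" "q' = 1" using p' le2 \<open>q' > 0\<close> by auto
  then show ?thesis using q'(1) a by (auto simp: n_def)
qed

section \<open>From lattice tilings to transversals, and the conclusion\<close>

lemma lattice_transversal_Upsilon:
  fixes \<Lambda> :: "(int ^ 'n) set"
  assumes "is_integer_lattice \<Lambda>" "is_tiling Upsilon \<Lambda>"
  shows "lattice_transversal \<Lambda> Upsilon"
proof
  obtain G :: "int ^ 'n ^ 'n" where G: "\<Lambda> = range (\<lambda>u. u v* G)"
    using assms(1) unfolding is_integer_lattice_def is_generator_matrix_def by blast
  show sub: "add_subgroup \<Lambda>"
    unfolding add_subgroup_def
  proof (intro conjI ballI)
    have "0 = 0 v* G" by (simp add: vec_eq_iff vector_matrix_mult_def)
    then show "0 \<in> \<Lambda>" unfolding G by (rule range_eqI)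
    fix x y assume "x \<in> \<Lambda>" "y \<in> \<Lambda>"
    then obtain u w where "x = u v* G" "y = w v* G" unfolding G by blast
    then have "x - y = (u - w) v* G"
      by (simp add: vec_eq_iff vector_matrix_mult_def algebra_simps sum_subtractf)
    then show "x - y \<in> \<Lambda>" unfolding G by (rule range_eqI)
  qed
  show "finite (Upsilon :: (int ^ 'n) set)" by (rule finite_Upsilon)
  show "\<exists>u\<in>Upsilon. x - u \<in> \<Lambda>" for x
  proof -
    have "x \<in> (\<Union>X\<in>\<Lambda>. (+) X ` Upsilon)" using assms(2) unfolding is_tiling_def by blast
    then obtain X u where "X \<in> \<Lambda>" "u \<in> Upsilon" "x = X + u" by blast
    then show ?thesis by (intro bexI[of _ u]) simp_all
  qed
  show "u = v" if *: "u \<in> Upsilon" "v \<in> Upsilon" "u - v \<in> \<Lambda>" for u v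
  proof (rule ccontr)
    assume "u \<noteq> v"
    then have "u - v \<noteq> 0" by simp
    \<comment> \<open>Two tile points in the same coset would put \<open>u\<close> into the
      translates by \<open>u - v\<close> and by 0, which are disjoint.\<close>
    then have "(+) (u - v) ` Upsilon \<inter> (+) 0 ` Upsilon = {}"
      using assms(2) add_subgroup_zero[OF sub] *(3)
      unfolding is_tiling_def disjoint_family_on_def by blast
    moreover have "u \<in> (+) (u - v) ` Upsilon" using *(2) by (intro image_eqI[of _ _ v]) auto
    moreover have "u \<in> (+) 0 ` Upsilon" using *(1) by simp
    ultimately show False by blast
  qed
qed

lemma no_odd_prime_divisor_imp_power_two:
  fixes m :: nat
  assumes "m > 0" "\<And>p. prime p \<Longrightarrow> p dvd m \<Longrightarrow> even p"
  shows "\<exists>t. m = 2 ^ t"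
proof -
  have "\<exists>t k. m = 2 ^ t * k \<and> odd k"
    by (rule multiplicity_decompose'[of m 2]) (use assms(1) in simp, simp, blast)
  then obtain t k where tk: "m = 2 ^ t * k" "odd k" by blast
  have "k = 1"
  proof (rule ccontr)
    assume "k \<noteq> 1"
    then obtain p where "prime p" "p dvd k" using prime_factor_nat by blast
    moreover from this have "even p" using assms(2) tk(1) by simp
    ultimately show False using tk(2) by (meson dvd_trans)
  qed
  then show ?thesis using tk(1) by simp
qed

theorem theorem3:
  fixes \<Lambda> :: "(int ^ 'n) set"
  assumes "is_integer_lattice \<Lambda>"
    and "is_tiling Upsilon \<Lambda>"
  shows "(\<exists>t>0. CARD('n) = 2 ^ t - 1) \<or> (\<exists>t>0. CARD('n) = 3 ^ t - 1)"
proof (cases "\<exists>p. prime p \<and> odd p \<and> p dvd CARD('n) + 1")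
  case True
  then obtain t where "t > 0" "CARD('n) + 1 = 3 ^ t"
    using tiling_odd_prime[OF lattice_transversal_Upsilon[OF assms]] by blast
  then have "CARD('n) = 3 ^ t - 1" by simp
  then show ?thesis using \<open>t > 0\<close> by blast
next
  case False
  then obtain t where t: "CARD('n) + 1 = 2 ^ t"
    using no_odd_prime_divisor_imp_power_two[of "CARD('n) + 1"] by auto
  \<comment> \<open>Exponent 0 would make the dimension 0.\<close>
  then have "t > 0" by (cases t) auto
  moreover have "CARD('n) = 2 ^ t - 1" using t by simp
  ultimately show ?thesis by blast
qed

end
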